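(* Let $\langle P,V\rangle$ and $\langle Q,V\rangle$ be states (with the same valuation $V$) in the labelled transition system with state set $\mathcal{P}\times\mathcal{V}$ and label set $TL$, and suppose that all states reachable from $\langle P,V\rangle$ and from $\langle Q,V\rangle$ are image-finite. Then $\langle P,V\rangle$ and $\langle Q,V\rangle$ are state-based bisimilar if and only if for all $\mathrm{HML}^{check}$ formulas $\phi$ we have $\langle P,V\rangle\in[\![\phi]\!]\Leftrightarrow\langle Q,V\rangle\in[\![\phi]\!]$.
   Context: **Process algebra with global variables.** Fix a data domain $D$, a finite set $Var$ of global variable names, a set $Act$ of actions, and a set $PN$ of process names. The transition labels are $TL = Act\cup\{assign(v,d)\mid v\in Var, d\in D\}$ (with $assign(v,d)$ formal labels). Process expressions (the set $\mathcal{P}$) are generated by $$P ::= \lambda.P \mid \delta \mid P+P \mid P\|P \mid \partial_B(P) \mid X \mid (v=d)\to P,$$ with $\lambda\in TL$, $B\subseteq Act$, $X\in PN$, $v\in Var$, $d\in D$. A recursive specification is fixed, containing exactly one equation $X\stackrel{\mathrm{def}}{=}t$ with $t\in\mathcal{P}$ for every $X\in PN$; it is guarded: in each equation $X\stackrel{\mathrm{def}}{=}t$ every occurrence of $X$ in $t$ is in the scope of an action prefix. A partial, commutative and associative function $\gamma:Act\times Act\rightharpoonup Act$ is fixed, such that if $\gamma(a,b)=c$ then $\gamma(c,d)$ is undefined for every $d$. A valuation is a function $V:Var\to D$; $\mathcal{V}$ is the set of valuations, and $V[v\mapsto d]$ is $V$ updated to map $v$ to $d$. States are pairs $\langle P,V\rangle\in\mathcal{P}\times\mathcal{V}$.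 The transition relation is the least relation closed under (with $a,b,c\in Act$, $\lambda\in TL$): - $\langle a.P,V\rangle\xrightarrow{a}\langle P,V\rangle$; $\langle assign(v,d).P,V\rangle\xrightarrow{assign(v,d)}\langle P,V[v\mapsto d]\rangle$; - if $\langle P,V\rangle\xrightarrow{\lambda}\langle P',V'\rangle$ then: $\langle (v=d)\to P,V\rangle\xrightarrow{\lambda}\langle P',V'\rangle$ provided $V(v)=d$; $\langle X,V\rangle\xrightarrow{\lambda}\langle P',V'\rangle$ provided $X\stackrel{\mathrm{def}}{=}P$; $\langle P+Q,V\rangle\xrightarrow{\lambda}\langle P',V'\rangle$ and $\langle Q+P,V\rangle\xrightarrow{\lambda}\langle P',V'\rangle$; $\langle P\|Q,V\rangle\xrightarrow{\lambda}\langle P'\|Q,V'\rangle$ and $\langle Q\|P,V\rangle\xrightarrow{\lambda}\langle Q\|P',V'\rangle$; $\langle\partial_B(P),V\rangle\xrightarrow{\lambda}\langle\partial_B(P'),V'\rangle$ provided $\lambda\notin B$; - if $\langle P,V\rangle\xrightarrow{a}\langle P',V\rangle$, $\langle Q,V\rangle\xrightarrow{b}\langle Q',V\rangle$ and $\gamma(a,b)=c$, then $\langle P\|Q,V\rangle\xrightarrow{c}\langle P'\|Q',V\rangle$. **State-based bisimilarity.** $R\subseteq(\mathcal{P}\times\mathcal{V})\times(\mathcal{P}\times\mathcal{V})$ is a state-based bisimulation if $(\langle P,V_1\rangle,\langle Q,V_2\rangle)\in R$ implies $V_1=V_2$ and, for all $\lambda\in TL$: whenever $\langle P,V_1\rangle\xrightarrow{\lambda}\langle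 P',V'\rangle$ there is $Q'$ with $\langle Q,V_2\rangle\xrightarrow{\lambda}\langle Q',V'\rangle$ and $(\langle P',V'\rangle,\langle Q',V'\rangle)\in R$; and whenever $\langle Q,V_2\rangle\xrightarrow{\lambda}\langle Q',V'\rangle$ there is $P'$ with $\langle P,V_1\rangle\xrightarrow{\lambda}\langle P',V'\rangle$ and $(\langle P',V'\rangle,\langle Q',V'\rangle)\in R$. Two states are state-based bisimilar if some state-based bisimulation relates them. **Reachability and image-finiteness.** A state $s'$ is reachable from $s$ if there is a finite (possibly empty) sequence of transitions from $s$ to $s'$. A state $\langle P,V\rangle$ is image-finite if for every label $\lambda$ the set $\{\langle P',V'\rangle\mid\langle P,V\rangle\xrightarrow{\lambda}\langle P',V'\rangle\}$ is finite. **Logic $\mathrm{HML}^{check}$.** Formulas: $$\phi ::= true\mid false\mid (v=e)\mid\neg\phi\mid\phi\wedge\phi\mid\phi\vee\phi\mid\langle T\rangle\phi\mid[T]\phi,$$ with $T$ a nonempty finite subset of $TL$, $v\in Var$, $e\in D$. With $S=\mathcal{P}\times\mathcal{V}$, the interpretation $[\![\phi]\!]\subseteq S$ is: $[\![true]\!]=S$, $[\![false]\!]=\emptyset$, $[\![v=e]\!]=\{\langle P,V\rangle\mid V(v)=e\}$; $\neg,\wedge,\vee$ are complement, intersection, union; $[\![\langle T\rangle\phi]\!]=\{u\mid\exists u'\in[\![\phi]\!],\lambda\in T: u\xrightarrow{\lambda}u'\}$; $[\![[T]\phi]\!]=\{u\mid\forall u'\in S,\lambda\in T: u\xrightarrow{\lambda}u'\Rightarrow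 u'\in[\![\phi]\!]\}$. *)

theory Defs
  imports Main
begin

datatype ('a, 'v, 'd) label = Act 'a | Assign 'v 'd

datatype ('a, 'v, 'd, 'p) proc =
    Prefix "('a, 'v, 'd) label" "('a, 'v, 'd, 'p) proc"
  | Deadlock
  | Choice "('a, 'v, 'd, 'p) proc" "('a, 'v, 'd, 'p) proc"
  | Par "('a, 'v, 'd, 'p) proc" "('a, 'v, 'd, 'p) proc"
  | Encap "'a set" "('a, 'v, 'd, 'p) proc"
  | Name 'p
  | Check 'v 'd "('a, 'v, 'd, 'p) proc"

type_synonym ('v, 'd) valuation = "'v \<Rightarrow> 'd"

type_synonym ('a, 'v, 'd, 'p) state = "('a, 'v, 'd, 'p) proc \<times> ('v, 'd) valuation"

text \<open>A recursive specification is a total function from process names to their defining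
  expressions, so that every name has exactly one equation.\<close>

type_synonym ('a, 'v, 'd, 'p) spec = "'p \<Rightarrow> ('a, 'v, 'd, 'p) proc"

text \<open>Names with an occurrence outside the scope of every prefix. A prefix with an assignment
  label counts as a guard, too.\<close>

primrec unguarded_names :: "('a, 'v, 'd, 'p) proc \<Rightarrow> 'p set" where
  "unguarded_names (Prefix l P) = {}"
| "unguarded_names Deadlock = {}"
| "unguarded_names (Choice P Q) = unguarded_names P \<union> unguarded_names Q"
| "unguarded_names (Par P Q) = unguarded_names P \<union> unguarded_names Q"
| "unguarded_names (Encap B P) = unguarded_names P"
| "unguarded_names (Name X) = {X}"
| "unguarded_names (Check v d P) = unguarded_names P"

text \<open>Guardedness only concerns the occurrences of a name in its own equation.\<close>

definition guarded_spec :: "('a, 'v, 'd, 'p) spec \<Rightarrow> bool" where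
  "guarded_spec E \<longleftrightarrow> (\<forall>X. X \<notin> unguarded_names (E X))"

text \<open>Commutativity and associativity of a partial operation are understood as Kleene equalities:
  both sides are undefined, or both are defined and equal.\<close>

definition communication_function :: "('a \<Rightarrow> 'a \<Rightarrow> 'a option) \<Rightarrow> bool" where
  "communication_function \<gamma> \<longleftrightarrow>
     (\<forall>a b. \<gamma> a b = \<gamma> b a) \<and>
     (\<forall>a b c. Option.bind (\<gamma> a b) (\<lambda>x. \<gamma> x c) = Option.bind (\<gamma> b c) (\<lambda>y. \<gamma> a y)) \<and>
     (\<forall>a b c d. \<gamma> a b = Some c \<longrightarrow> \<gamma> c d = None)"

inductive step ::
  "('a \<Rightarrow> 'a \<Rightarrow> 'a option) \<Rightarrow> ('a, 'v, 'd, 'p) spec \<Rightarrow>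
   ('a, 'v, 'd, 'p) state \<Rightarrow> ('a, 'v, 'd) label \<Rightarrow> ('a, 'v, 'd, 'p) state \<Rightarrow> bool"
  for \<gamma> :: "'a \<Rightarrow> 'a \<Rightarrow> 'a option" and E :: "('a, 'v, 'd, 'p) spec"
where
  act: "step \<gamma> E (Prefix (Act a) P, V) (Act a) (P, V)"
| assign: "step \<gamma> E (Prefix (Assign v d) P, V) (Assign v d) (P, V(v := d))"
| check: "step \<gamma> E (P, V) l (P', V') \<Longrightarrow> V v = d \<Longrightarrow> step \<gamma> E (Check v d P, V) l (P', V')"
| name: "step \<gamma> E (P, V) l (P', V') \<Longrightarrow> E X = P \<Longrightarrow> step \<gamma> E (Name X, V) l (P', V')"
| choice_left: "step \<gamma> E (P, V) l (P', V') \<Longrightarrow> step \<gamma> E (Choice P Q, V) l (P', V')"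
| choice_right: "step \<gamma> E (P, V) l (P', V') \<Longrightarrow> step \<gamma> E (Choice Q P, V) l (P', V')"
| par_left: "step \<gamma> E (P, V) l (P', V') \<Longrightarrow> step \<gamma> E (Par P Q, V) l (Par P' Q, V')"
| par_right: "step \<gamma> E (P, V) l (P', V') \<Longrightarrow> step \<gamma> E (Par Q P, V) l (Par Q P', V')"
| encap: "step \<gamma> E (P, V) l (P', V') \<Longrightarrow> l \<notin> Act ` B \<Longrightarrow>
    step \<gamma> E (Encap B P, V) l (Encap B P', V')"
| comm: "step \<gamma> E (P, V) (Act a) (P', V) \<Longrightarrow> step \<gamma> E (Q, V) (Act b) (Q', V) \<Longrightarrow>
    \<gamma> a b = Some c \<Longrightarrow> step \<gamma> E (Par P Q, V) (Act c) (Par P' Q', V)"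

definition reachable ::
  "('a \<Rightarrow> 'a \<Rightarrow> 'a option) \<Rightarrow> ('a, 'v, 'd, 'p) spec \<Rightarrow>
   ('a, 'v, 'd, 'p) state \<Rightarrow> ('a, 'v, 'd, 'p) state \<Rightarrow> bool" where
  "reachable \<gamma> E = (\<lambda>s s'. \<exists>l. step \<gamma> E s l s')\<^sup>*\<^sup>*"

definition image_finite ::
  "('a \<Rightarrow> 'a \<Rightarrow> 'a option) \<Rightarrow> ('a, 'v, 'd, 'p) spec \<Rightarrow> ('a, 'v, 'd, 'p) state \<Rightarrow> bool" where
  "image_finite \<gamma> E s \<longleftrightarrow> (\<forall>l. finite {s'. step \<gamma> E s l s'})"

definition state_based_bisimulation ::
  "('a \<Rightarrow> 'a \<Rightarrow> 'a option) \<Rightarrow> ('a, 'v, 'd, 'p) spec \<Rightarrow>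
   (('a, 'v, 'd, 'p) state \<times> ('a, 'v, 'd, 'p) state) set \<Rightarrow> bool" where
  "state_based_bisimulation \<gamma> E R \<longleftrightarrow>
     (\<forall>P V\<^sub>1 Q V\<^sub>2. ((P, V\<^sub>1), (Q, V\<^sub>2)) \<in> R \<longrightarrow>
        V\<^sub>1 = V\<^sub>2 \<and>
        (\<forall>l P' V'. step \<gamma> E (P, V\<^sub>1) l (P', V') \<longrightarrow>
           (\<exists>Q'. step \<gamma> E (Q, V\<^sub>2) l (Q', V') \<and> ((P', V'), (Q', V')) \<in> R)) \<and>
        (\<forall>l Q' V'. step \<gamma> E (Q, V\<^sub>2) l (Q', V') \<longrightarrow>
           (\<exists>P'. step \<gamma> E (P, V\<^sub>1) l (P', V') \<and> ((P', V'), (Q', V')) \<in> R)))"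

definition state_based_bisimilar ::
  "('a \<Rightarrow> 'a \<Rightarrow> 'a option) \<Rightarrow> ('a, 'v, 'd, 'p) spec \<Rightarrow>
   ('a, 'v, 'd, 'p) state \<Rightarrow> ('a, 'v, 'd, 'p) state \<Rightarrow> bool" where
  "state_based_bisimilar \<gamma> E s t \<longleftrightarrow> (\<exists>R. state_based_bisimulation \<gamma> E R \<and> (s, t) \<in> R)"

text \<open>The datatype admits arbitrary label sets in the modalities; the formulas of the logic are
  those satisfying \<open>wf_formula\<close>, where these sets are nonempty and finite.\<close>

datatype ('a, 'v, 'd) formula =
    TT
  | FF
  | VarEq 'v 'd
  | Neg "('a, 'v, 'd) formula"
  | Conj "('a, 'v, 'd) formula" "('a, 'v, 'd) formula"
  | Disj "('a, 'v, 'd) formula" "('a, 'v, 'd) formula"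
  | Diamond "('a, 'v, 'd) label set" "('a, 'v, 'd) formula"
  | Box "('a, 'v, 'd) label set" "('a, 'v, 'd) formula"

primrec wf_formula :: "('a, 'v, 'd) formula \<Rightarrow> bool" where
  "wf_formula TT \<longleftrightarrow> True"
| "wf_formula FF \<longleftrightarrow> True"
| "wf_formula (VarEq v e) \<longleftrightarrow> True"
| "wf_formula (Neg \<phi>) \<longleftrightarrow> wf_formula \<phi>"
| "wf_formula (Conj \<phi> \<psi>) \<longleftrightarrow> wf_formula \<phi> \<and> wf_formula \<psi>"
| "wf_formula (Disj \<phi> \<psi>) \<longleftrightarrow> wf_formula \<phi> \<and> wf_formula \<psi>"
| "wf_formula (Diamond T \<phi>) \<longleftrightarrow> finite T \<and> T \<noteq> {} \<and> wf_formula \<phi>"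
| "wf_formula (Box T \<phi>) \<longleftrightarrow> finite T \<and> T \<noteq> {} \<and> wf_formula \<phi>"

primrec interp ::
  "('a \<Rightarrow> 'a \<Rightarrow> 'a option) \<Rightarrow> ('a, 'v, 'd, 'p) spec \<Rightarrow>
   ('a, 'v, 'd) formula \<Rightarrow> ('a, 'v, 'd, 'p) state set" where
  "interp \<gamma> E TT = UNIV"
| "interp \<gamma> E FF = {}"
| "interp \<gamma> E (VarEq v e) = {(P, V). V v = e}"
| "interp \<gamma> E (Neg \<phi>) = - interp \<gamma> E \<phi>"
| "interp \<gamma> E (Conj \<phi> \<psi>) = interp \<gamma> E \<phi> \<inter> interp \<gamma> E \<psi>"
| "interp \<gamma> E (Disj \<phi> \<psi>) = interp \<gamma> E \<phi> \<union> interp \<gamma> E \<psi>"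
| "interp \<gamma> E (Diamond T \<phi>) = {u. \<exists>u'\<in>interp \<gamma> E \<phi>. \<exists>l\<in>T. step \<gamma> E u l u'}"
| "interp \<gamma> E (Box T \<phi>) = {u. \<forall>u'. \<forall>l\<in>T. step \<gamma> E u l u' \<longrightarrow> u' \<in> interp \<gamma> E \<phi>}"

end

theory Submission
  imports Defs
begin

text \<open>The Hennessy-Milner argument: satisfaction of the same formulas is itself a bisimulation on
  the reachable states. The formulas \<open>v = e\<close> force equal valuations. If a step to \<open>s'\<close> had no
  matching step, then each of the finitely many successors under the same label would be separated
  from \<open>s'\<close> by a formula, and the diamond over the conjunction of these formulas would separate
  the original states.\<close>

text \<open>The two states may carry different valuations: agreement has to be derived, because a
  bisimulation demands it of matched successors too.\<close>

definition logically_equivalent ::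
  "('a \<Rightarrow> 'a \<Rightarrow> 'a option) \<Rightarrow> ('a, 'v, 'd, 'p) spec \<Rightarrow>
   ('a, 'v, 'd, 'p) state \<Rightarrow> ('a, 'v, 'd, 'p) state \<Rightarrow> bool" where
  "logically_equivalent \<gamma> E s t \<longleftrightarrow>
     (\<forall>\<phi>. wf_formula \<phi> \<longrightarrow> (s \<in> interp \<gamma> E \<phi> \<longleftrightarrow> t \<in> interp \<gamma> E \<phi>))"

lemma logically_equivalent_sym:
  "logically_equivalent \<gamma> E s t \<Longrightarrow> logically_equivalent \<gamma> E t s"
  by (simp add: logically_equivalent_def)

lemma logically_equivalent_valuation:
  assumes "logically_equivalent \<gamma> E (P, V) (Q, W)"
  shows "V = W"
proof
  fix v
  \<comment> \<open>The constant is the value of \<open>v\<close> in the first state, so the formula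
    holds there.\<close>
  have "(P, V) \<in> interp \<gamma> E (VarEq v (V v)) \<longleftrightarrow> (Q, W) \<in> interp \<gamma> E (VarEq v (V v))"
    using assms unfolding logically_equivalent_def by (meson wf_formula.simps(3))
  then show "V v = W v" by simp
qed

lemma reachable_step:
  "reachable \<gamma> E s t \<Longrightarrow> step \<gamma> E t l u \<Longrightarrow> reachable \<gamma> E s u"
  unfolding reachable_def by (rule rtranclp.rtrancl_into_rtrancl) auto

text \<open>Structural induction on \<open>\<phi>\<close>, over all related pairs at once because
  the modalities pass to successors. Each label in a modality is matched separately.\<close>

lemma bisimulation_interp_iff:
  assumes R: "state_based_bisimulation \<gamma> E R" and "(s, t) \<in> R"
  shows "s \<in> interp \<gamma> E \<phi> \<longleftrightarrow> t \<in> interp \<gamma> E \<phi>"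
proof -
  have forward: "\<exists>t'. step \<gamma> E t l t' \<and> (s', t') \<in> R" if "(s, t) \<in> R" "step \<gamma> E s l s'" for s t l s'
    using R that unfolding state_based_bisimulation_def
    by (metis surj_pair)
  have backward: "\<exists>s'. step \<gamma> E s l s' \<and> (s', t') \<in> R" if "(s, t) \<in> R" "step \<gamma> E t l t'" for s t l t'
    using R that unfolding state_based_bisimulation_def
    by (metis surj_pair)
  from \<open>(s, t) \<in> R\<close> show ?thesis
  proof (induction \<phi> arbitrary: s t)
    case (VarEq v e)
    then have "snd s = snd t"
      using R unfolding state_based_bisimulation_def by (metis prod.collapse)
    then show ?case by (simp add: case_prod_beta)
  next
    case (Diamond T \<phi>)
    show ?case
    proof
      assume "s \<in> interp \<gamma> E (Diamond T \<phi>)"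
      then obtain l s' where "l \<in> T" "step \<gamma> E s l s'" "s' \<in> interp \<gamma> E \<phi>" by auto
      with forward[OF Diamond.prems] Diamond.IH show "t \<in> interp \<gamma> E (Diamond T \<phi>)"
        by fastforce
    next
      assume "t \<in> interp \<gamma> E (Diamond T \<phi>)"
      then obtain l t' where "l \<in> T" "step \<gamma> E t l t'" "t' \<in> interp \<gamma> E \<phi>" by auto
      with backward[OF Diamond.prems] Diamond.IH show "s \<in> interp \<gamma> E (Diamond T \<phi>)"
        by fastforce
    qed
  next
    case (Box T \<phi>)
    \<comment> \<open>The directions cross: a box passes from \<open>s\<close> to \<open>t\<close>
      by \<open>backward\<close>, since each step of \<open>t\<close> must be traced to a step of
      \<open>s\<close>; the converse uses \<open>forward\<close>.\<close>
    show ?case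
      using forward[OF Box.prems] backward[OF Box.prems] Box.IH by simp metis
  qed auto
qed

text \<open>Conjunction is binary, so taking one conjunct per state calls for a finite
  \<open>A\<close>; the empty conjunction is \<open>TT\<close>.\<close>

lemma distinguishing_formula:
  assumes "finite A" and "\<And>t. t \<in> A \<Longrightarrow> \<not> logically_equivalent \<gamma> E s t"
  shows "\<exists>\<phi>. wf_formula \<phi> \<and> s \<in> interp \<gamma> E \<phi> \<and> A \<inter> interp \<gamma> E \<phi> = {}"
  using assms
proof (induction A rule: finite_induct)
  case empty
  have "wf_formula TT \<and> s \<in> interp \<gamma> E TT \<and> {} \<inter> interp \<gamma> E TT = {}" by simp
  then show ?case ..
next
  case (insert t A)
  then obtain \<phi> where \<phi>: "wf_formula \<phi>" "s \<in> interp \<gamma> E \<phi>" "A \<inter> interp \<gamma> E \<phi> = {}" by auto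
  obtain \<psi> where "wf_formula \<psi>" "s \<in> interp \<gamma> E \<psi> \<longleftrightarrow> t \<notin> interp \<gamma> E \<psi>"
    using insert.prems[of t] unfolding logically_equivalent_def by blast
  \<comment> \<open>The separating formula may hold at \<open>t\<close> instead of \<open>s\<close>;
    its negation then has the right orientation.\<close>
  then obtain \<chi> where \<chi>: "wf_formula \<chi>" "s \<in> interp \<gamma> E \<chi>" "t \<notin> interp \<gamma> E \<chi>"
    by (metis ComplI ComplD interp.simps(4) wf_formula.simps(4))
  have "wf_formula (Conj \<phi> \<chi>) \<and> s \<in> interp \<gamma> E (Conj \<phi> \<chi>) \<and>
      insert t A \<inter> interp \<gamma> E (Conj \<phi> \<chi>) = {}"
    using \<phi> \<chi> by auto
  then show ?case ..
qed

text \<open>Finiteness is asked of the answering state \<open>t\<close>, whose successors under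
  \<open>l\<close> are the ones to be separated from \<open>s'\<close>.\<close>

lemma logically_equivalent_step:
  assumes "logically_equivalent \<gamma> E s t" and "image_finite \<gamma> E t" and "step \<gamma> E s l s'"
  shows "\<exists>t'. step \<gamma> E t l t' \<and> logically_equivalent \<gamma> E s' t'"
proof (rule ccontr)
  assume "\<not> ?thesis"
  moreover have "finite {t'. step \<gamma> E t l t'}"
    using assms(2) by (simp add: image_finite_def)
  ultimately obtain \<phi> where \<phi>: "wf_formula \<phi>" "s' \<in> interp \<gamma> E \<phi>"
      "{t'. step \<gamma> E t l t'} \<inter> interp \<gamma> E \<phi> = {}"
    using distinguishing_formula[of "{t'. step \<gamma> E t l t'}" \<gamma> E s'] by auto
  \<comment> \<open>The singleton is a legal label set and insists on the same label
    \<open>l\<close> in the answer.\<close>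
  have "wf_formula (Diamond {l} \<phi>)" using \<phi>(1) by simp
  moreover have "s \<in> interp \<gamma> E (Diamond {l} \<phi>)" using \<phi>(2) assms(3) by auto
  moreover have "t \<notin> interp \<gamma> E (Diamond {l} \<phi>)" using \<phi>(3) by auto
  ultimately show False
    using assms(1) unfolding logically_equivalent_def by blast
qed

text \<open>Reachability is built into the relation so that image-finiteness is at hand for every
  related pair; steps preserve it.\<close>

lemma logically_equivalent_bisimulation:
  assumes "\<And>u. reachable \<gamma> E s u \<Longrightarrow> image_finite \<gamma> E u"
    and "\<And>u. reachable \<gamma> E t u \<Longrightarrow> image_finite \<gamma> E u"
  shows "state_based_bisimulation \<gamma> E
    {(u, w). reachable \<gamma> E s u \<and> reachable \<gamma> E t w \<and> logically_equivalent \<gamma> E u w}"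
  (is "state_based_bisimulation \<gamma> E ?R")
  unfolding state_based_bisimulation_def
proof (intro allI impI conjI)
  fix P V Q W
  assume "((P, V), (Q, W)) \<in> ?R"
  then have reach: "reachable \<gamma> E s (P, V)" "reachable \<gamma> E t (Q, W)"
    and equiv: "logically_equivalent \<gamma> E (P, V) (Q, W)"
    by auto
  show "V = W" using equiv by (rule logically_equivalent_valuation)
  fix l
  show "\<exists>Q'. step \<gamma> E (Q, W) l (Q', V') \<and> ((P', V'), (Q', V')) \<in> ?R"
    if step: "step \<gamma> E (P, V) l (P', V')" for P' V'
  proof -
    \<comment> \<open>The valuation \<open>W'\<close> of the answer is open at first; equivalence of
      the successors then forces \<open>W' = V'\<close>.\<close>
    obtain Q' W' where Q': "step \<gamma> E (Q, W) l (Q', W')"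
        "logically_equivalent \<gamma> E (P', V') (Q', W')"
      using logically_equivalent_step[OF equiv assms(2)[OF reach(2)] step] by auto
    then show ?thesis
      using logically_equivalent_valuation[OF Q'(2)] reachable_step[OF reach(1) step]
        reachable_step[OF reach(2) Q'(1)] by auto
  qed
  show "\<exists>P'. step \<gamma> E (P, V) l (P', V') \<and> ((P', V'), (Q', V')) \<in> ?R"
    if step: "step \<gamma> E (Q, W) l (Q', V')" for Q' V'
  proof -
    \<comment> \<open>Here \<open>(P, V)\<close> answers, so the equivalence is reversed first and
      reversed back for the successors.\<close>
    obtain P' W' where P': "step \<gamma> E (P, V) l (P', W')"
        "logically_equivalent \<gamma> E (Q', V') (P', W')"
      using logically_equivalent_step[OF logically_equivalent_sym[OF equiv]
          assms(1)[OF reach(1)] step] by auto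
    then show ?thesis
      using logically_equivalent_valuation[OF P'(2)] logically_equivalent_sym[OF P'(2)]
        reachable_step[OF reach(1) P'(1)] reachable_step[OF reach(2) step] by auto
  qed
qed

theorem theorem12:
  fixes \<gamma> :: "'a \<Rightarrow> 'a \<Rightarrow> 'a option"
    and E :: "('a, 'v::finite, 'd, 'p) spec"
    and P Q :: "('a, 'v, 'd, 'p) proc"
    and V :: "('v, 'd) valuation"
  assumes "communication_function \<gamma>"
    and "guarded_spec E"
    and "\<And>s. reachable \<gamma> E (P, V) s \<Longrightarrow> image_finite \<gamma> E s"
    and "\<And>s. reachable \<gamma> E (Q, V) s \<Longrightarrow> image_finite \<gamma> E s"
  shows "state_based_bisimilar \<gamma> E (P, V) (Q, V) \<longleftrightarrow>
    (\<forall>\<phi>. wf_formula \<phi> \<longrightarrow> ((P, V) \<in> interp \<gamma> E \<phi> \<longleftrightarrow> (Q, V) \<in> interp \<gamma> E \<phi>))"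
proof
  assume "state_based_bisimilar \<gamma> E (P, V) (Q, V)"
  then show "\<forall>\<phi>. wf_formula \<phi> \<longrightarrow> ((P, V) \<in> interp \<gamma> E \<phi> \<longleftrightarrow> (Q, V) \<in> interp \<gamma> E \<phi>)"
    unfolding state_based_bisimilar_def using bisimulation_interp_iff by blast
next
  assume "\<forall>\<phi>. wf_formula \<phi> \<longrightarrow> ((P, V) \<in> interp \<gamma> E \<phi> \<longleftrightarrow> (Q, V) \<in> interp \<gamma> E \<phi>)"
  then have "logically_equivalent \<gamma> E (P, V) (Q, V)"
    by (simp add: logically_equivalent_def)
  \<comment> \<open>The empty path puts the initial pair itself into the bisimulation.\<close>
  moreover have "reachable \<gamma> E (P, V) (P, V)" "reachable \<gamma> E (Q, V) (Q, V)"
    by (simp_all add: reachable_def)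
  ultimately show "state_based_bisimilar \<gamma> E (P, V) (Q, V)"
    unfolding state_based_bisimilar_def
    using logically_equivalent_bisimulation[OF assms(3,4)] by blast
qed

end
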